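(* For every finite simple connected graph $G$ it holds that $\operatorname{diam}(G) \leq \gamma_{cg}(G) + 1$ and $\operatorname{diam}(G) \leq \gamma_{cg}'(G)$.
   Context: The connected domination game on a graph $G$ is played by two players, Dominator and Staller, who alternately select vertices. A vertex $w$ is a legal move if (a) its closed neighborhood $N[w]$ contains at least one vertex not in the union of the closed neighborhoods of the previously selected vertices (i.e. it dominates a new vertex), and (b) unless it is the first move, $w$ is adjacent to at least one already selected vertex. The game ends when no legal move exists; on a connected graph the selected vertices then form a connected dominating set. Dominator wants to minimize the total number of moves, Staller wants to maximize it. $\gamma_{cg}(G)$ is the number of moves under optimal play when Dominator moves first (D-game), and $\gamma_{cg}'(G)$ is the number of moves under optimal play when Staller moves first (S-game). *)

theory Defs
  imports "Graph_Theory.Graph_Theory"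
begin

text \<open>
  Finite simple graphs are the \<^locale>\<open>graph\<close>s: finite, loopfree, symmetric digraphs
  without parallel arcs, so every undirected edge is a pair of opposite arcs.
\<close>

definition diam :: "('a, 'b) pre_digraph \<Rightarrow> ereal" where
  "diam G = (SUP u\<in>verts G. SUP v\<in>verts G. wf_digraph.\<mu> G (\<lambda>_. 1) u v)"

definition closed_nbhd :: "('a, 'b) pre_digraph \<Rightarrow> 'a \<Rightarrow> 'a set" where
  "closed_nbhd G w = insert w {v. w \<rightarrow>\<^bsub>G\<^esub> v}"

text \<open>\<open>S\<close> is the set of vertices selected so far; \<open>S = {}\<close> means that the next move is the first one.\<close>

definition legal_moves :: "('a, 'b) pre_digraph \<Rightarrow> 'a set \<Rightarrow> 'a set" where
  "legal_moves G S = {w \<in> verts G.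
     \<not> closed_nbhd G w \<subseteq> (\<Union>s\<in>S. closed_nbhd G s) \<and>
     (S \<noteq> {} \<longrightarrow> (\<exists>s\<in>S. w \<rightarrow>\<^bsub>G\<^esub> s))}"

datatype player = Dominator | Staller

text \<open>
  The number of further moves under optimal play when \<open>S\<close> has been selected and the given player
  moves next. On infinite vertex sets the value 0 is a dummy that makes the recursion terminate.
\<close>

function moves_left :: "('a, 'b) pre_digraph \<Rightarrow> player \<Rightarrow> 'a set \<Rightarrow> nat" where
  "moves_left G p S =
    (if infinite (verts G) \<or> legal_moves G S = {} then 0
     else Suc (case p of
         Dominator \<Rightarrow> Min ((\<lambda>w. moves_left G Staller (insert w S)) ` legal_moves G S)
       | Staller \<Rightarrow> Max ((\<lambda>w. moves_left G Dominator (insert w S)) ` legal_moves G S)))"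
  by pat_completeness auto
termination
proof (relation "measure (\<lambda>(G, p, S). card (verts G - S))", goal_cases)
  case 1
  show ?case by simp
next
  case (2 G p S w)
  then have "finite (verts G)" "w \<in> verts G" "w \<notin> S"
    by (auto simp: legal_moves_def)
  then have "verts G - insert w S \<subset> verts G - S" by blast
  with \<open>finite (verts G)\<close> show ?case by (simp add: psubset_card_mono)
next
  case (3 G p S w)
  then have "finite (verts G)" "w \<in> verts G" "w \<notin> S"
    by (auto simp: legal_moves_def)
  then have "verts G - insert w S \<subset> verts G - S" by blast
  with \<open>finite (verts G)\<close> show ?case by (simp add: psubset_card_mono)
qed

declare moves_left.simps [simp del]

definition gamma_cg :: "('a, 'b) pre_digraph \<Rightarrow> nat" where
  "gamma_cg G = moves_left G Dominator {}"

definition gamma_cg' :: "('a, 'b) pre_digraph \<Rightarrow> nat" where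
  "gamma_cg' G = moves_left G Staller {}"

end

theory Submission
  imports Defs
begin

text \<open>
  The selected vertices always induce a connected subgraph, so any two of \<open>k\<close> selected vertices are
  joined by a walk of length less than \<open>k\<close>. When the game ends they form a dominating set; hence any
  two vertices of the graph have distance at most \<open>k + 1\<close>, and at most \<open>k\<close> if one of them was
  selected. In the S-game Staller secures the better bound by starting at an end of a longest
  geodesic.
\<close>

lemma closed_nbhd_self: "w \<in> closed_nbhd G w"
  by (simp add: closed_nbhd_def)

lemma legal_moves_notin: "w \<in> legal_moves G S \<Longrightarrow> w \<notin> S"
  by (auto simp: legal_moves_def)

lemma legal_moves_subset_verts: "legal_moves G S \<subseteq> verts G"
  by (auto simp: legal_moves_def)

lemma legal_moves_empty: "legal_moves G {} = verts G"
  by (auto simp: legal_moves_def closed_nbhd_def)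

lemma legal_moves_adjE:
  assumes "w \<in> legal_moves G S" "S \<noteq> {}"
  obtains s where "s \<in> S" "w \<rightarrow>\<^bsub>G\<^esub> s"
  using assms by (auto simp: legal_moves_def)

lemma finite_legal_moves: "finite (verts G) \<Longrightarrow> finite (legal_moves G S)"
  by (rule finite_subset[OF legal_moves_subset_verts])

lemma moves_left_eq_0_iff:
  assumes "finite (verts G)"
  shows "moves_left G p S = 0 \<longleftrightarrow> legal_moves G S = {}"
  using assms by (simp add: moves_left.simps[of G p S])

text \<open>A minimum or maximum over a finite nonempty set is attained, so some legal move is
  optimal. Who moves next is left as some \<open>q\<close>: later arguments only count the moves of
  one optimal play.\<close>

lemma moves_left_SucE:
  assumes fin: "finite (verts G)" and n: "moves_left G p S = Suc n"
  obtains w q where "w \<in> legal_moves G S" "moves_left G q (insert w S) = n"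
proof -
  have ne: "legal_moves G S \<noteq> {}"
    using moves_left_eq_0_iff[OF fin, of p S] n by simp
  note img = finite_imageI[OF finite_legal_moves[OF fin]]
  show ?thesis
  proof (cases p)
    case Dominator
    let ?A = "(\<lambda>w. moves_left G Staller (insert w S)) ` legal_moves G S"
    have "Min ?A \<in> ?A" by (rule Min_in[OF img]) (use ne in simp)
    moreover have "Min ?A = n"
      using n fin ne by (simp add: Dominator moves_left.simps[of G Dominator S])
    ultimately have "n \<in> ?A" by simp
    then show ?thesis using that by blast
  next
    case Staller
    let ?A = "(\<lambda>w. moves_left G Dominator (insert w S)) ` legal_moves G S"
    have "Max ?A \<in> ?A" by (rule Max_in[OF img]) (use ne in simp)
    moreover have "Max ?A = n"
      using n fin ne by (simp add: Staller moves_left.simps[of G Staller S])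
    ultimately have "n \<in> ?A" by simp
    then show ?thesis using that by blast
  qed
qed

text \<open>Staller's value is a maximum, so each single move of hers gives a lower bound for it.
  This allows her opening vertex to be prescribed in the S-game.\<close>

lemma moves_left_Staller_ge:
  assumes fin: "finite (verts G)" and w: "w \<in> legal_moves G S"
  shows "Suc (moves_left G Dominator (insert w S)) \<le> moves_left G Staller S"
proof -
  have "moves_left G Dominator (insert w S)
      \<le> Max ((\<lambda>w. moves_left G Dominator (insert w S)) ` legal_moves G S)"
    using fin w by (intro Max_ge finite_imageI finite_legal_moves imageI)
  moreover have "legal_moves G S \<noteq> {}" using w by blast
  ultimately show ?thesis
    using fin by (simp add: moves_left.simps[of G Staller S])
qed

context wf_digraph
begin

text \<open>The invariant of the play: a quantitative trace of the fact that \<open>S\<close>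
  induces a connected subgraph. The walks may leave \<open>S\<close>, since only their lengths enter
  the distance bounds.\<close>

definition walk_bounded :: "'a set \<Rightarrow> bool" where
  "walk_bounded S \<longleftrightarrow> S \<noteq> {} \<and> S \<subseteq> verts G \<and>
     (\<forall>s\<in>S. \<forall>t\<in>S. \<exists>p. awalk s p t \<and> length p < card S)"

lemma walk_bounded_walkE:
  assumes "walk_bounded S" "s \<in> S" "t \<in> S"
  obtains p where "awalk s p t" "length p < card S"
  using assms unfolding walk_bounded_def by blast

lemma walk_bounded_singleton: "v \<in> verts G \<Longrightarrow> walk_bounded {v}"
  by (auto simp: walk_bounded_def intro!: exI[of _ "[]"] simp: awalk_Nil_iff)

text \<open>\<open>\<mu>\<close> is an infimum of walk costs, and with unit weights the cost of a
  walk is its length.\<close>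

lemma \<mu>_one_le_length: "awalk u p v \<Longrightarrow> \<mu> (\<lambda>_. 1) u v \<le> ereal (real (length p))"
  using min_cost_le_walk_cost[of u p v "\<lambda>_. 1"]
  by (simp add: awalk_cost_def sum_list_triv)

lemma adj_awalkE:
  assumes "u \<rightarrow>\<^bsub>G\<^esub> v"
  obtains e where "awalk u [e] v"
  using assms by (auto simp: arcs_ends_conv intro: arc_implies_awalk)

end

context graph
begin

lemma adj_sym: "u \<rightarrow>\<^bsub>G\<^esub> v \<Longrightarrow> v \<rightarrow>\<^bsub>G\<^esub> u"
  using sym_arcs by (rule arcs_ends_symmetric)

text \<open>A legal move \<open>w\<close> has a selected neighbour \<open>s\<close>, so walks to or
  from \<open>s\<close> reach \<open>w\<close> with one more arc. The bound also grows by one,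
  because a legal move is never an already selected vertex.\<close>

lemma walk_bounded_insert:
  assumes S: "walk_bounded S" and w: "w \<in> legal_moves G S"
  shows "walk_bounded (insert w S)"
proof -
  have sub: "S \<subseteq> verts G" and "S \<noteq> {}" and wV: "w \<in> verts G"
    using S w by (auto simp: walk_bounded_def legal_moves_def)
  obtain s where s: "s \<in> S" "w \<rightarrow>\<^bsub>G\<^esub> s"
    using w \<open>S \<noteq> {}\<close> by (rule legal_moves_adjE)
  obtain e where e: "awalk w [e] s" using s(2) by (rule adj_awalkE)
  obtain e' where e': "awalk s [e'] w" using adj_sym[OF s(2)] by (rule adj_awalkE)
  have card: "card (insert w S) = Suc (card S)"
    using legal_moves_notin[OF w] finite_subset[OF sub] by simp
  have "\<exists>p. awalk x p y \<and> length p < Suc (card S)"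
    if xy: "x \<in> insert w S" "y \<in> insert w S" for x y
  proof -
    consider "x = w" "y = w" | "x = w" "y \<in> S" | "x \<in> S" "y = w" | "x \<in> S" "y \<in> S"
      using xy by blast
    then show ?thesis
    proof cases
      case 1
      then show ?thesis using wV by (intro exI[of _ "[]"]) (simp add: awalk_Nil_iff)
    next
      case 2
      then obtain p where "awalk s p y" "length p < card S" using S s(1) by (metis walk_bounded_walkE)
      then show ?thesis
        using awalk_appendI[OF e] 2 by (intro exI[of _ "[e] @ p"]) auto
    next
      case 3
      then obtain p where "awalk x p s" "length p < card S" using S s(1) by (metis walk_bounded_walkE)
      then show ?thesis
        using awalk_appendI[OF _ e'] 3 by (intro exI[of _ "p @ [e']"]) auto
    next
      case 4
      then show ?thesis using S by (metis walk_bounded_walkE less_SucI)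
    qed
  qed
  then show ?thesis using sub wV by (auto simp: walk_bounded_def card)
qed

text \<open>Play an optimal move at every turn until none is left; each move adds exactly one new
  vertex and keeps the invariant. The induction is on the number of remaining moves, with player and
  position arbitrary.\<close>

lemma final_positionE:
  assumes "walk_bounded S"
  obtains T where "S \<subseteq> T" "walk_bounded T" "legal_moves G T = {}"
    "card T = card S + moves_left G p S"
proof -
  have "\<exists>T. S \<subseteq> T \<and> walk_bounded T \<and> legal_moves G T = {} \<and> card T = card S + n"
    if "moves_left G p S = n" "walk_bounded S" for n p S
    using that
  proof (induction n arbitrary: p S)
    case 0
    then show ?case using moves_left_eq_0_iff[of G p S] by auto
  next
    case (Suc n)
    obtain w q where w: "w \<in> legal_moves G S" "moves_left G q (insert w S) = n"
      using moves_left_SucE[OF finite_verts Suc.prems(1)] .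
    have "finite S"
      using Suc.prems(2) finite_subset[of S "verts G"] by (simp add: walk_bounded_def)
    then have "card (insert w S) = Suc (card S)" using legal_moves_notin[OF w(1)] by simp
    with Suc.IH[OF w(2) walk_bounded_insert[OF Suc.prems(2) w(1)]] show ?case by auto
  qed
  then show ?thesis using assms that by blast
qed

text \<open>Domination spreads from a selected vertex along arcs: an undominated vertex next to a
  dominated one would leave a legal move.\<close>

lemma final_position_dominating:
  assumes con: "connected G" and S: "S \<noteq> {}" "S \<subseteq> verts G" and final: "legal_moves G S = {}"
    and v: "v \<in> verts G"
  shows "\<exists>s\<in>S. v \<in> closed_nbhd G s"
proof -
  obtain s where s: "s \<in> S" using S by blast
  \<comment> \<open>\<open>connected\<close> refers to the symmetric closure
    \<open>mk_symmetric G\<close>; since \<open>G\<close> is symmetric, reachability there is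
    reachability in \<open>G\<close>.\<close>
  have "s \<rightarrow>\<^sup>*\<^bsub>mk_symmetric G\<^esub> v"
    using con v s S by (auto simp: connected_def strongly_connected_def)
  then have "s \<rightarrow>\<^sup>* v"
    by (simp only: reachable_mk_symmetric_eq[OF sym_arcs])
  then show ?thesis
  proof (induction rule: reachable_induct)
    case base
    show ?case using closed_nbhd_self s by (rule bexI)
  next
    case (step x y)
    from step.IH obtain t where t: "t \<in> S" "x \<in> closed_nbhd G t" ..
    show ?case
    proof (cases "x \<in> S")
      case True
      then show ?thesis using \<open>x \<rightarrow>\<^bsub>G\<^esub> y\<close> by (auto simp: closed_nbhd_def)
    next
      case False
      \<comment> \<open>An unselected but dominated \<open>x\<close> has a selected neighbour, so it
        can fail to be legal only by dominating nothing new; hence its neighbour \<open>y\<close> is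
        already dominated.\<close>
      then have "x \<rightarrow>\<^bsub>G\<^esub> t" using t by (auto simp: closed_nbhd_def intro: adj_sym)
      moreover have "x \<in> verts G" using \<open>x \<rightarrow>\<^bsub>G\<^esub> y\<close> by (rule adj_in_verts)
      ultimately have "closed_nbhd G x \<subseteq> (\<Union>s\<in>S. closed_nbhd G s)"
        using final t(1) by (auto simp: legal_moves_def)
      then show ?thesis using \<open>x \<rightarrow>\<^bsub>G\<^esub> y\<close> by (auto simp: closed_nbhd_def)
    qed
  qed
qed

text \<open>The strict bound inside \<open>T\<close> leaves room for one last arc, from a selected
  vertex to the vertex \<open>v\<close> that it dominates.\<close>

lemma final_walk_from_selected:
  assumes "connected G" "walk_bounded T" "legal_moves G T = {}" "s \<in> T" "v \<in> verts G"
  shows "\<exists>p. awalk s p v \<and> length p \<le> card T"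
proof -
  obtain t where t: "t \<in> T" "v \<in> closed_nbhd G t"
    using final_position_dominating[of T v] assms by (auto simp: walk_bounded_def)
  obtain p where p: "awalk s p t" "length p < card T"
    using assms(2,4) t(1) by (rule walk_bounded_walkE)
  show ?thesis
  proof (cases "v = t")
    case True
    then show ?thesis using p by auto
  next
    case False
    then have "t \<rightarrow>\<^bsub>G\<^esub> v" using t by (simp add: closed_nbhd_def)
    then obtain e where "awalk t [e] v" by (rule adj_awalkE)
    from awalk_appendI[OF p(1) this] show ?thesis
      using p(2) by (intro exI[of _ "p @ [e]"]) simp
  qed
qed

text \<open>If \<open>u\<close> is not selected either, one further arc at the start leads from
  \<open>u\<close> into \<open>T\<close>.\<close>

lemma final_walk:
  assumes "connected G" "walk_bounded T" "legal_moves G T = {}" "u \<in> verts G" "v \<in> verts G"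
  shows "\<exists>p. awalk u p v \<and> length p \<le> card T + 1"
proof -
  obtain t where t: "t \<in> T" "u \<in> closed_nbhd G t"
    using final_position_dominating[of T u] assms by (auto simp: walk_bounded_def)
  obtain p where p: "awalk t p v" "length p \<le> card T"
    using final_walk_from_selected assms t by blast
  show ?thesis
  proof (cases "u = t")
    case True
    then show ?thesis using p by auto
  next
    case False
    then have "u \<rightarrow>\<^bsub>G\<^esub> t" using t by (auto simp: closed_nbhd_def intro: adj_sym)
    then obtain e where "awalk u [e] t" by (rule adj_awalkE)
    from awalk_appendI[OF this p(1)] show ?thesis
      using p(2) by (intro exI[of _ "[e] @ p"]) simp
  qed
qed

lemma diam_le_gamma_cg:
  assumes con: "connected G"
  shows "diam G \<le> ereal (real (gamma_cg G + 1))"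
  unfolding diam_def
proof (intro SUP_least)
  fix u v assume uv: "u \<in> verts G" "v \<in> verts G"
  \<comment> \<open>The invariant requires a nonempty selection, so the first move is split off and
    the play is followed from \<open>{w}\<close>.\<close>
  have "gamma_cg G \<noteq> 0"
    using uv moves_left_eq_0_iff[of G Dominator "{}"] by (auto simp: gamma_cg_def legal_moves_empty)
  then obtain n where n: "gamma_cg G = Suc n" by (cases "gamma_cg G") auto
  obtain w q where w: "w \<in> verts G" "moves_left G q {w} = n"
    using moves_left_SucE[OF finite_verts n[unfolded gamma_cg_def]] by (auto simp: legal_moves_empty)
  obtain T where "walk_bounded T" "legal_moves G T = {}" "card T = Suc n"
    using final_positionE[OF walk_bounded_singleton[OF w(1)], of q] w(2) by auto
  then obtain p where p: "awalk u p v" "length p \<le> gamma_cg G + 1"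
    using final_walk[OF con _ _ uv] n by metis
  show "\<mu> (\<lambda>_. 1) u v \<le> ereal (real (gamma_cg G + 1))"
    using \<mu>_one_le_length[OF p(1)] by (rule order_trans) (use p(2) in simp)
qed

lemma diam_le_gamma_cg':
  assumes con: "connected G"
  shows "diam G \<le> ereal (real (gamma_cg' G))"
  unfolding diam_def
proof (intro SUP_least)
  fix u v assume uv: "u \<in> verts G" "v \<in> verts G"
  \<comment> \<open>Each pair is treated separately: Staller opens at \<open>u\<close> and the play
    is optimal from then on, so \<open>u\<close> belongs to the final selection and the extra arc at
    its end is saved.\<close>
  obtain T where T: "{u} \<subseteq> T" "walk_bounded T" "legal_moves G T = {}"
      "card T = Suc (moves_left G Dominator {u})"
    using final_positionE[OF walk_bounded_singleton[OF uv(1)], of Dominator] by auto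
  \<comment> \<open>Opening at \<open>u\<close> may be suboptimal for Staller, which only makes this
    play shorter than or as long as the optimal one.\<close>
  have "card T \<le> gamma_cg' G"
    using moves_left_Staller_ge[of G u "{}"] uv T(4) by (simp add: gamma_cg'_def legal_moves_empty)
  moreover obtain p where p: "awalk u p v" "length p \<le> card T"
    using final_walk_from_selected[OF con T(2,3) _ uv(2)] T(1) by blast
  ultimately show "\<mu> (\<lambda>_. 1) u v \<le> ereal (real (gamma_cg' G))"
    using \<mu>_one_le_length[OF p(1)] by (elim order_trans) simp
qed

end

theorem proposition2p2:
  fixes G :: "('a, 'b) pre_digraph"
  assumes "graph G" and "connected G"
  shows "diam G \<le> ereal (real (gamma_cg G + 1)) \<and> diam G \<le> ereal (real (gamma_cg' G))"
  using graph.diam_le_gamma_cg[OF assms] graph.diam_le_gamma_cg'[OF assms] by blast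

end
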